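(* Let $q>2$ be a prime power and let $X$, $\sigma$, $V_0,\dots,V_4$ be as in the context. Suppose that $Y$ is a nonempty proper subset of $X$ such that $\chi_Y\in V_0\oplus V_i$ for some $i\in\{1,2,3,4\}$ (that is, $Y$ is an intriguing set of type $i$). (a) If $i=1$ or $i=3$, then $|Y|=\tfrac12|X|$ and $|\{p,p^\sigma\}\cap Y|=1$ for all $p\in X$. (b) If $i=2$ or $i=4$, then $Y^\sigma=Y$.
   Context: Let $q>2$ be a prime power. Let $\mathcal Q$ denote (the point set of) an elliptic quadric $\mathsf{Q}^-(5,q)$ in $\mathrm{PG}(5,q)$ and let $\perp$ be the associated polarity of $\mathrm{PG}(5,q)$, whose absolute points are the points of $\mathcal Q$. Let $H$ be a hyperplane with $H\cap\mathcal Q$ a parabolic quadric $\mathsf Q(4,q)$, and let $X:=\mathcal Q\setminus H$ (so $|X|=q^2(q^2-1)$). Two points $u,v$ of $\mathcal Q$ are collinear, written $u\sim v$, if $u\ne v$ and $v\in u^\perp$ (i.e. the line $uv$ lies in $\mathcal Q$). For $p\in X$ the line joining the point $H^\perp$ and $p$ meets $\mathcal Q$ in exactly one further point $p^\sigma\in X$; $\sigma$ is (the restriction to $X$ of) the central collineation of $\mathrm{PG}(5,q)$ with axis $H$ and centre $H^\perp$ mapping $p$ to $p^\sigma$; it is an involution, commutes with $\perp$, and has no fixed points on $X$. For $S\subseteq X$, $S^\sigma:=\{s^\sigma:s\in S\}$. Define relations on $X$: $R_0=\{(u,v):u=v\}$, $R_1=\{(u,v): v\not\sim u\sim v^\sigma\}$,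 $R_2=\{(u,v): v\not\sim u\not\sim v^\sigma\}$, $R_3=\{(u,v): v\sim u\not\sim v^\sigma\}$, $R_4=\{(u,v):u=v^\sigma\}$, with adjacency matrices $A_0,\dots,A_4$ (rows/columns indexed by $X$). These form a symmetric association scheme, and $\mathbb R^X$ is the orthogonal direct sum of the common eigenspaces $V_0,\dots,V_4$, with $V_0$ spanned by the all-ones vector $j$, numbered so that $A_kv=P_{ik}v$ for $v\in V_i$, where (rows $i=0,\dots,4$, columns $k=0,\dots,4$) $P=\begin{pmatrix}1&(q-1)(q^2+1)&(q-2)q(q^2+1)&(q-1)(q^2+1)&1\\1&q^2+1&0&-(q^2+1)&-1\\1&q-1&-2q&q-1&1\\1&-(q-1)&0&q-1&-1\\1&-(q-1)^2&2(q-2)q&-(q-1)^2&1\end{pmatrix}.$ For $Y\subseteq X$, $\chi_Y$ is its characteristic vector. An intriguing set of type $i$ ($i\in\{1,2,3,4\}$) is a nonempty proper subset $Y$ of $X$ with $\chi_Y\in V_0\oplus V_i$.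
   Formalization: R_2 is taken to exclude the pairs (u,u) and (u,u^σ), which its printed definition includes, contradicting the stated matrix P; for even q the points of the quadric are the singular points of the quadratic form, since every point is then absolute for the polarity. *)

theory Defs
  imports "HOL-Analysis.Analysis"
begin

text \<open>
  The points of \<open>PG(5,q)\<close> are the one-dimensional subspaces of \<open>GF(q)\<^sup>6\<close>, where \<open>GF(q)\<close> is
  a type \<open>'a\<close> of classes field and finite with \<open>q = CARD('a)\<close>; general subspaces of \<open>PG(5,q)\<close>
  are linear subspaces, and incidence is inclusion. Quadrics are given by quadratic forms, so
  that both parities of \<open>q\<close> are covered. The polarity \<open>\<perp>\<close> is the one of the polar form; for even
  \<open>q\<close> it is symplectic, and the points of the quadric are the singular points of the form, not
  all the absolute points of \<open>\<perp>\<close>.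
\<close>

definition polar_form :: "('a::field^6 \<Rightarrow> 'a) \<Rightarrow> 'a^6 \<Rightarrow> 'a^6 \<Rightarrow> 'a" where
  "polar_form Q x y = Q (x + y) - Q x - Q y"

text \<open>The polar form is symmetric, so linearity in one argument is bilinearity.\<close>

definition quadratic_form :: "('a::field^6 \<Rightarrow> 'a) \<Rightarrow> bool" where
  "quadratic_form Q \<longleftrightarrow>
     (\<forall>c x. Q (c *s x) = c\<^sup>2 * Q x) \<and>
     (\<forall>y. Vector_Spaces.linear (*s) (*) (\<lambda>x. polar_form Q x y))"

text \<open>
  The quadric cut out by \<open>Q\<close> on the subspace \<open>W\<close> has no singular point. In characteristic 2 the
  polar form restricted to \<open>W\<close> may still be degenerate.
\<close>

definition nonsingular_on :: "('a::field^6) set \<Rightarrow> ('a^6 \<Rightarrow> 'a) \<Rightarrow> bool" where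
  "nonsingular_on W Q \<longleftrightarrow>
     (\<forall>x\<in>W. Q x = 0 \<and> (\<forall>y\<in>W. polar_form Q x y = 0) \<longrightarrow> x = 0)"

definition totally_singular :: "('a::field^6 \<Rightarrow> 'a) \<Rightarrow> ('a^6) set \<Rightarrow> bool" where
  "totally_singular Q W \<longleftrightarrow> vec.subspace W \<and> (\<forall>x\<in>W. Q x = 0)"

definition witt_index :: "('a::{field,finite}^6 \<Rightarrow> 'a) \<Rightarrow> nat" where
  "witt_index Q = Max (vec.dim ` {W. totally_singular Q W})"

text \<open>
  A nonsingular quadric of \<open>PG(5,q)\<close> is hyperbolic (Witt index 3) or elliptic (Witt index 2,
  i.e. it contains lines but no planes).
\<close>

definition elliptic_form :: "('a::{field,finite}^6 \<Rightarrow> 'a) \<Rightarrow> bool" where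
  "elliptic_form Q \<longleftrightarrow> quadratic_form Q \<and> nonsingular_on UNIV Q \<and> witt_index Q = 2"

text \<open>Every nonsingular quadric of a four-dimensional projective space is parabolic.\<close>

definition parabolic_hyperplane :: "('a::field^6 \<Rightarrow> 'a) \<Rightarrow> ('a^6) set \<Rightarrow> bool" where
  "parabolic_hyperplane Q H \<longleftrightarrow> vec.subspace H \<and> vec.dim H = 5 \<and> nonsingular_on H Q"

definition quadric :: "('a::field^6 \<Rightarrow> 'a) \<Rightarrow> ('a^6) set set" where
  "quadric Q = {vec.span {x} |x. x \<noteq> 0 \<and> Q x = 0}"

definition perp :: "('a::field^6 \<Rightarrow> 'a) \<Rightarrow> ('a^6) set \<Rightarrow> ('a^6) set" where
  "perp Q W = {y. \<forall>x\<in>W. polar_form Q x y = 0}"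

definition collinear_pts :: "('a::field^6 \<Rightarrow> 'a) \<Rightarrow> ('a^6) set \<Rightarrow> ('a^6) set \<Rightarrow> bool" where
  "collinear_pts Q u v \<longleftrightarrow> u \<noteq> v \<and> v \<subseteq> perp Q u"

definition affine_pts :: "('a::field^6 \<Rightarrow> 'a) \<Rightarrow> ('a^6) set \<Rightarrow> ('a^6) set set" where
  "affine_pts Q H = {p \<in> quadric Q. \<not> p \<subseteq> H}"

text \<open>
  \<open>p\<^sup>\<sigma>\<close> is the second point of the quadric on the line joining the points \<open>H\<^sup>\<perp>\<close> and \<open>p\<close>.
\<close>

definition conj_pt :: "('a::field^6 \<Rightarrow> 'a) \<Rightarrow> ('a^6) set \<Rightarrow> ('a^6) set \<Rightarrow> ('a^6) set" where
  "conj_pt Q H p = (THE r. r \<in> quadric Q \<and> r \<noteq> p \<and> r \<subseteq> vec.span (perp Q H \<union> p))"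

text \<open>
  Since collinear points are distinct by definition, the pairs \<open>(u,u)\<close> and \<open>(u,u\<^sup>\<sigma>)\<close> also satisfy
  \<open>v \<not>\<sim> u \<not>\<sim> v\<^sup>\<sigma>\<close>. They are excluded from \<open>R\<^sub>2\<close>, as required for the five relations to partition
  \<open>X \<times> X\<close> and for \<open>R\<^sub>2\<close> to have valency \<open>(q - 2)q(q\<^sup>2 + 1)\<close>.
\<close>

definition scheme_rel ::
  "('a::field^6 \<Rightarrow> 'a) \<Rightarrow> ('a^6) set \<Rightarrow> nat \<Rightarrow> (('a^6) set \<times> ('a^6) set) set" where
  "scheme_rel Q H k = {(u, v). u \<in> affine_pts Q H \<and> v \<in> affine_pts Q H \<and>
     [u = v,
      \<not> collinear_pts Q u v \<and> collinear_pts Q u (conj_pt Q H v),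
      \<not> collinear_pts Q u v \<and> \<not> collinear_pts Q u (conj_pt Q H v) \<and> u \<noteq> v \<and> u \<noteq> conj_pt Q H v,
      collinear_pts Q u v \<and> \<not> collinear_pts Q u (conj_pt Q H v),
      u = conj_pt Q H v] ! k}"

definition adj_matrix ::
  "('a::field^6 \<Rightarrow> 'a) \<Rightarrow> ('a^6) set \<Rightarrow> nat \<Rightarrow> ('a^6) set \<Rightarrow> ('a^6) set \<Rightarrow> real" where
  "adj_matrix Q H k u v = (if (u, v) \<in> scheme_rel Q H k then 1 else 0)"

definition eigenmatrix :: "real \<Rightarrow> nat \<Rightarrow> nat \<Rightarrow> real" where
  "eigenmatrix q i k =
    [[1, (q - 1) * (q\<^sup>2 + 1), (q - 2) * q * (q\<^sup>2 + 1), (q - 1) * (q\<^sup>2 + 1), 1],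
     [1, q\<^sup>2 + 1, 0, - (q\<^sup>2 + 1), - 1],
     [1, q - 1, - 2 * q, q - 1, 1],
     [1, - (q - 1), 0, q - 1, - 1],
     [1, - (q - 1)\<^sup>2, 2 * (q - 2) * q, - (q - 1)\<^sup>2, 1]] ! i ! k"

text \<open>
  A vector of \<open>\<real>\<^sup>X\<close> is represented by a real function on all sets of vectors that vanishes
  outside \<open>X\<close>. The rows of the eigenmatrix are distinct for \<open>q > 2\<close>, so each of them determines
  the common eigenspace \<open>V\<^sub>i\<close>; for \<open>i = 0\<close> this is the span of the all-ones vector.
\<close>

definition eigenspace ::
  "('a::{field,finite}^6 \<Rightarrow> 'a) \<Rightarrow> ('a^6) set \<Rightarrow> nat \<Rightarrow> (('a^6) set \<Rightarrow> real) set" where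
  "eigenspace Q H i = {f. (\<forall>u. u \<notin> affine_pts Q H \<longrightarrow> f u = 0) \<and>
     (\<forall>k\<le>4. \<forall>u\<in>affine_pts Q H.
        (\<Sum>v\<in>affine_pts Q H. adj_matrix Q H k u v * f v) = eigenmatrix (real CARD('a)) i k * f u)}"

definition intriguing_set ::
  "('a::{field,finite}^6 \<Rightarrow> 'a) \<Rightarrow> ('a^6) set \<Rightarrow> nat \<Rightarrow> ('a^6) set set \<Rightarrow> bool" where
  "intriguing_set Q H i Y \<longleftrightarrow> i \<in> {1, 2, 3, 4} \<and> Y \<noteq> {} \<and> Y \<subset> affine_pts Q H \<and>
     (\<exists>f\<in>eigenspace Q H 0. \<exists>g\<in>eigenspace Q H i. indicator Y = (\<lambda>u. f u + g u))"

end

theory Submission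
  imports Defs
begin

text \<open>
  Let \<open>n\<close> span \<open>H\<^sup>\<perp>\<close>. Then \<open>\<sigma>\<close> is induced by the reflection in \<open>n\<close>, and no point of \<open>X\<close> is
  orthogonal to both \<open>v\<close> and \<open>v\<^sup>\<sigma>\<close>, since it would lie in \<open>n\<^sup>\<perp> = H\<close>. Hence \<open>\<sigma>\<close> is an involution
  without fixed points and \<open>A\<^sub>0 + \<dots> + A\<^sub>4\<close> is the all-ones matrix; as the corresponding eigenvalue
  \<open>q\<^sup>2(q\<^sup>2 - 1)\<close> on \<open>V\<^sub>0\<close> is nonzero, \<open>V\<^sub>0\<close> consists of constant vectors. Elements of \<open>V\<^sub>i\<close> satisfy
  \<open>g(p\<^sup>\<sigma>) = \<plusminus>g(p)\<close>, by the last column of the eigenmatrix, with sign \<open>-\<close> exactly if \<open>i\<close> is 1 or 3.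
  So \<open>\<chi>\<^sub>Y\<close> is \<open>\<sigma>\<close>-invariant if \<open>i\<close> is 2 or 4, and \<open>\<chi>\<^sub>Y(p) + \<chi>\<^sub>Y(p\<^sup>\<sigma>)\<close> is constant, hence 1, otherwise.
\<close>

section \<open>Alternating forms\<close>

lemma linear_functional_simps:
  fixes f :: "'a::field^'n \<Rightarrow> 'a"
  assumes "Vector_Spaces.linear (*s) (*) f"
  shows "f (x + y) = f x + f y" "f (c *s x) = c * f x" "f 0 = 0" "f (x - y) = f x - f y" "f (- x) = - f x"
proof -
  interpret Vector_Spaces.linear "(*s)" "(*)" f by fact
  show "f (x + y) = f x + f y" "f (c *s x) = c * f x" "f 0 = 0" "f (x - y) = f x - f y" "f (- x) = - f x"
    by (simp_all add: add scale zero diff neg)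
qed

text \<open>Hyperbolic planes split off: as long as \<open>B\<close> is nonzero on \<open>W\<close>,
  vectors \<open>e\<close>, \<open>f\<close> with \<open>B e f\<close> nonzero span a plane whose
  orthogonal complement \<open>W'\<close> in \<open>W\<close> has dimension two less and the same
  radical.\<close>

lemma alternating_radical_parity:
  fixes B :: "'a::field^'n \<Rightarrow> 'a^'n \<Rightarrow> 'a"
  assumes l: "\<And>y. Vector_Spaces.linear (*s) (*) (\<lambda>x. B x y)"
    and r: "\<And>x. Vector_Spaces.linear (*s) (*) (B x)"
    and alt: "\<And>x. B x x = 0"
    and "vec.subspace W"
  shows "even (vec.dim W) \<longleftrightarrow> even (vec.dim {x\<in>W. \<forall>y\<in>W. B x y = 0})"
  using \<open>vec.subspace W\<close>
proof (induction "vec.dim W" arbitrary: W rule: less_induct)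
  case less
  note B = linear_functional_simps[OF l] linear_functional_simps[OF r]
  show ?case
  proof (cases "\<forall>x\<in>W. \<forall>y\<in>W. B x y = 0")
    case True
    then have "{x\<in>W. \<forall>y\<in>W. B x y = 0} = W" by auto
    then show ?thesis by simp
  next
    case False
    then obtain e f where ef: "e \<in> W" "f \<in> W" "B e f \<noteq> 0" by auto
    have skew: "B y x = - B x y" for x y
      using alt[of "x + y"] unfolding B by (simp add: alt eq_neg_iff_add_eq_0 add.commute)
    define W' where "W' = {x\<in>W. B x e = 0 \<and> B x f = 0}"
    have sub': "vec.subspace W'"
      using less.prems unfolding W'_def vec.subspace_def by (auto simp: B)
    have decomp: "\<exists>a b. w - a *s e - b *s f \<in> W'" if "w \<in> W" for w
    proof (intro exI)
      \<comment> \<open>The coefficients cancel the products with \<open>f\<close> and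
        \<open>e\<close>, since \<open>B e e\<close> and \<open>B f f\<close> vanish.\<close>
      show "w - (B w f / B e f) *s e - (B w e / B f e) *s f \<in> W'"
        using that ef less.prems skew[of e f]
        by (auto simp: W'_def B alt intro!: vec.subspace_add vec.subspace_diff vec.subspace_scale)
    qed
    have f_notin: "f \<notin> vec.span W'"
      using ef skew[of e f] sub' by (auto simp: W'_def vec.span_eq_iff[THEN iffD2])
    have e_notin: "e \<notin> vec.span (insert f W')"
    proof
      assume "e \<in> vec.span (insert f W')"
      then obtain k where "e - k *s f \<in> W'"
        using sub' by (auto simp: vec.span_insert vec.span_eq_iff[THEN iffD2])
      then have "B (e - k *s f) f = 0" by (simp add: W'_def)
      then show False using ef by (simp add: B alt)
    qed
    have "vec.span (insert e (insert f W')) = W"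
    proof
      show "vec.span (insert e (insert f W')) \<subseteq> W"
        using ef less.prems by (intro vec.span_minimal) (auto simp: W'_def)
      show "W \<subseteq> vec.span (insert e (insert f W'))"
      proof
        fix w assume "w \<in> W"
        then obtain a b where "w - a *s e - b *s f \<in> W'" using decomp by blast
        then show "w \<in> vec.span (insert e (insert f W'))"
          unfolding vec.span_insert by (blast intro: vec.span_base)
      qed
    qed
    then have "vec.dim W = vec.dim (insert e (insert f W'))"
      using vec.dim_span by metis
    also have "\<dots> = vec.dim W' + 2"
      using e_notin f_notin by (simp add: vec.dim_insert)
    finally have dim: "vec.dim W = vec.dim W' + 2" .
    \<comment> \<open>Vectors of \<open>W'\<close> are orthogonal to \<open>e\<close> and
      \<open>f\<close>, so orthogonality to \<open>W'\<close> extends to \<open>W\<close>.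
      Conversely, the radical of \<open>W\<close> lies in \<open>W'\<close>.\<close>
    have "{x\<in>W'. \<forall>y\<in>W'. B x y = 0} = {x\<in>W. \<forall>y\<in>W. B x y = 0}"
    proof (intro set_eqI iffI)
      fix x assume x: "x \<in> {x\<in>W'. \<forall>y\<in>W'. B x y = 0}"
      have "B x y = 0" if y: "y \<in> W" for y
      proof -
        obtain a b where "y - a *s e - b *s f \<in> W'" using decomp y by blast
        then have "B x (y - a *s e - b *s f) = 0" using x by simp
        then show ?thesis using x by (simp add: B W'_def)
      qed
      then show "x \<in> {x\<in>W. \<forall>y\<in>W. B x y = 0}" using x by (simp add: W'_def)
    qed (use ef in \<open>auto simp: W'_def\<close>)
    then show ?thesis using less.hyps[of W'] dim sub' by simp
  qed
qed

section \<open>Quadratic forms and their polar forms\<close>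

locale quadratic_space =
  fixes Q :: "'a::{field,finite}^6 \<Rightarrow> 'a"
  assumes quadratic: "quadratic_form Q"
begin

abbreviation B :: "'a^6 \<Rightarrow> 'a^6 \<Rightarrow> 'a" where "B \<equiv> polar_form Q"

lemma Q_scale: "Q (c *s x) = c\<^sup>2 * Q x"
  using quadratic by (simp add: quadratic_form_def)

lemma Q_add: "Q (x + y) = Q x + Q y + B x y"
  by (simp add: polar_form_def)

lemma B_commute: "B x y = B y x"
  by (simp add: polar_form_def add.commute)

lemma B_linear_left: "Vector_Spaces.linear (*s) (*) (\<lambda>x. B x y)"
  using quadratic by (simp add: quadratic_form_def)

lemma B_linear_right: "Vector_Spaces.linear (*s) (*) (B x)"
  using B_linear_left[of x] by (simp add: B_commute[of _ x])

lemmas B_simps =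
  linear_functional_simps[OF B_linear_left] linear_functional_simps[OF B_linear_right]

lemma B_self: "B x x = 2 * Q x"
proof -
  have "x + x = 2 *s x" by (simp add: vec_eq_iff)
  then show ?thesis by (simp add: polar_form_def Q_scale power2_eq_square)
qed

lemma subspace_perp_vector: "vec.subspace {x. B x y = 0}"
  by (auto simp: vec.subspace_def B_simps)

lemma B_span_eq_0:
  assumes "\<And>x. x \<in> S \<Longrightarrow> B x y = 0" "x \<in> vec.span S"
  shows "B x y = 0"
  using vec.span_minimal[OF _ subspace_perp_vector, of S y] assms by auto

lemma subset_perp_spanD: "vec.span {y} \<subseteq> perp Q (vec.span {x}) \<Longrightarrow> B x y = 0"
  by (auto simp: perp_def subset_iff vec.span_base)

lemma self_subset_perp:
  assumes "Q x = 0"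
  shows "vec.span {x} \<subseteq> perp Q (vec.span {x})"
  using assms by (auto simp: perp_def vec.span_singleton B_simps B_self)

text \<open>
  A vector in the radical forces characteristic 2. There the radical has even dimension, and as
  every field element is a square, \<open>Q\<close> has a zero on any plane contained in it.
\<close>

lemma nondegenerate:
  assumes ns: "nonsingular_on UNIV Q" and r: "\<And>y. B r y = 0"
  shows "r = 0"
proof (rule ccontr)
  assume "r \<noteq> 0"
  have Qne: "Q s \<noteq> 0" if "s \<noteq> 0" "\<And>y. B s y = 0" for s
    using ns that by (auto simp: nonsingular_on_def)
  have "2 * Q r = 0" using B_self[of r] r by simp
  then have two: "(2::'a) = 0" using Qne[OF \<open>r \<noteq> 0\<close> r] by simp
  define R where "R = {x. \<forall>y. B x y = 0}"
  have "vec.dim (UNIV :: ('a^6) set) = 6"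
    by (simp add: card_cart_basis vec.dim_UNIV)
  then have "even (vec.dim R)"
    using alternating_radical_parity[OF B_linear_left B_linear_right _ vec.subspace_UNIV]
    by (simp add: B_self two R_def)
  moreover have "vec.dim (vec.span {r}) = 1"
    using \<open>r \<noteq> 0\<close> by (simp add: vec.dim_insert)
  ultimately have "R \<noteq> vec.span {r}" by auto
  moreover have "vec.span {r} \<subseteq> R"
    using r by (auto simp: R_def vec.span_singleton B_simps)
  ultimately obtain s where s: "s \<in> R" "s \<notin> vec.span {r}" by auto
  have "inj (\<lambda>c::'a. c\<^sup>2)"
  proof (rule injI)
    fix c d :: 'a assume "c\<^sup>2 = d\<^sup>2"
    \<comment> \<open>As 2 = 0, squaring is additive, so equal squares have equal roots.\<close>
    moreover have "(c - d)\<^sup>2 = c\<^sup>2 - d\<^sup>2 + 2 * (d\<^sup>2 - c * d)"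
      by (simp add: power2_eq_square algebra_simps)
    ultimately have "(c - d)\<^sup>2 = 0" using two by simp
    then show "c = d" by simp
  qed
  then have "surj (\<lambda>c::'a. c\<^sup>2)" by (rule finite_UNIV_inj_surj[OF finite])
  \<comment> \<open>Since \<open>s\<close> and \<open>r\<close> are orthogonal,
    \<open>Q (s + c *s r)\<close> is \<open>Q s\<close> plus the square of \<open>c\<close> times
    \<open>Q r\<close>; this \<open>c\<close> makes it 0.\<close>
  then obtain c where c: "c\<^sup>2 = - Q s / Q r" by (metis surjD)
  have "s + c *s r \<noteq> 0"
    using s(2) vec.span_scale[OF vec.span_base, of r "{r}" "- c"] by (auto simp: add_eq_0_iff2)
  moreover have "Q (s + c *s r) = 0"
    using c r s Qne[OF \<open>r \<noteq> 0\<close> r] by (simp add: Q_add Q_scale B_simps R_def)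
  moreover have "B (s + c *s r) y = 0" for y
    using r s by (simp add: B_simps R_def)
  ultimately show False using Qne by blast
qed

section \<open>The normal vector of the hyperplane\<close>

lemma perp_hyperplane_nontrivial:
  assumes "vec.dim H = 5"
  shows "\<exists>n. n \<noteq> 0 \<and> (\<forall>x\<in>H. B x n = 0)"
proof -
  obtain S where S: "S \<subseteq> H" "vec.independent S" "H \<subseteq> vec.span S" "card S = 5"
    using vec.basis_exists assms by metis
  have fin: "finite S" using S(4) card.infinite by fastforce
  \<comment> \<open>Pigeonhole: there are more vectors \<open>y\<close> than functions on the five
    basis vectors of \<open>H\<close>, and the difference of two vectors with the same image is
    orthogonal to \<open>H\<close>.\<close>
  let ?T = "\<lambda>y. \<lambda>x\<in>S. B x y"
  have "\<not> inj ?T"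
  proof
    assume "inj ?T"
    moreover have "range ?T \<subseteq> (S \<rightarrow>\<^sub>E UNIV)" by auto
    moreover have "finite (S \<rightarrow>\<^sub>E (UNIV :: 'a set))" using fin by (simp add: finite_PiE)
    ultimately have "CARD('a^6) \<le> card (S \<rightarrow>\<^sub>E (UNIV :: 'a set))" by (rule card_inj_on_le)
    then have "CARD('a) ^ 6 \<le> CARD('a) ^ 5" using fin S(4) by (simp add: card_PiE)
    moreover have "CARD('a) > 1"
      using card_mono[of UNIV "{0, 1::'a}"] by simp
    ultimately show False by simp
  qed
  then obtain y z where yz: "y \<noteq> z" "?T y = ?T z" by (auto simp: inj_def)
  have "B x (y - z) = 0" if "x \<in> S" for x
    using fun_cong[OF yz(2), of x] that by (simp add: B_simps)
  then have "\<forall>x\<in>H. B x (y - z) = 0" using S(3) B_span_eq_0 by blast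
  then show ?thesis using yz(1) by (intro exI[of _ "y - z"]) simp
qed

text \<open>A vector orthogonal to \<open>H\<close> and to some \<open>x\<close> outside
  \<open>H\<close> is orthogonal to everything, hence 0 by \<open>nondegenerate\<close>. All three
  properties of \<open>n\<close> rest on this.\<close>

lemma perp_hyperplane:
  assumes ns: "nonsingular_on UNIV Q" and par: "parabolic_hyperplane Q H"
  obtains n where "perp Q H = vec.span {n}" "Q n \<noteq> 0" "\<And>x. x \<notin> H \<Longrightarrow> B x n \<noteq> 0"
proof -
  have H: "vec.subspace H" "vec.dim H = 5" "nonsingular_on H Q"
    using par by (auto simp: parabolic_hyperplane_def)
  obtain n where n: "n \<noteq> 0" "\<And>x. x \<in> H \<Longrightarrow> B x n = 0"
    using perp_hyperplane_nontrivial[OF H(2)] by blast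
  have zero: "y = 0" if "x \<notin> H" "B x y = 0" "\<And>h. h \<in> H \<Longrightarrow> B h y = 0" for x y
  proof -
    have "vec.dim (insert x H) = vec.dim (UNIV :: ('a^6) set)"
      using that(1) H by (simp add: vec.dim_insert vec.span_eq_iff[THEN iffD2] card_cart_basis vec.dim_UNIV)
    then have "vec.span (insert x H) = UNIV"
      by (metis vec.dim_eq_full vec.dim_UNIV vec.dimension_def)
    then have "B z y = 0" for z
      using B_span_eq_0[of "insert x H" y z] that by auto
    then show ?thesis using nondegenerate[OF ns, of y] by (simp add: B_commute)
  qed
  have Bn: "B x n \<noteq> 0" if "x \<notin> H" for x using zero[OF that, of n] n by blast
  \<comment> \<open>If \<open>n\<close> lies in \<open>H\<close>, it is in the radical of
    \<open>H\<close>, on which \<open>Q\<close> is nonsingular; in characteristic 2 this is the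
    nucleus. Otherwise \<open>B n n = 2 * Q n\<close> is nonzero.\<close>
  have "Q n \<noteq> 0"
  proof (cases "n \<in> H")
    case True
    then show ?thesis using H(3) n by (auto simp: nonsingular_on_def B_commute)
  next
    case False
    then show ?thesis using Bn[of n] by (simp add: B_self)
  qed
  moreover have "perp Q H = vec.span {n}"
  proof
    show "vec.span {n} \<subseteq> perp Q H"
      using n by (auto simp: perp_def vec.span_singleton B_simps)
    have "H \<noteq> UNIV" using H(2) by (auto simp: card_cart_basis vec.dim_UNIV)
    then obtain x where x: "x \<notin> H" by auto
    show "perp Q H \<subseteq> vec.span {n}"
    proof
      fix y assume "y \<in> perp Q H"
      \<comment> \<open>The subtracted multiple of \<open>n\<close> makes the difference orthogonal
        to \<open>x\<close> as well as to \<open>H\<close>.\<close>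
      then have "y - (B x y / B x n) *s n = 0"
        using Bn[OF x] n by (intro zero[OF x]) (auto simp: B_simps perp_def)
      then show "y \<in> vec.span {n}" by (auto simp: vec.span_singleton)
    qed
  qed
  ultimately show ?thesis using that Bn by blast
qed

end

section \<open>The involution and the association scheme\<close>

locale parabolic_section = quadratic_space Q
  for Q :: "'a::{field,finite}^6 \<Rightarrow> 'a" +
  fixes H n
  assumes sub_H: "vec.subspace H"
    and perp_H: "perp Q H = vec.span {n}"
    and Qn: "Q n \<noteq> 0"
    and Bn: "\<And>x. x \<notin> H \<Longrightarrow> B x n \<noteq> 0"
begin

section \<open>The reflection in \<open>n\<close> and the involution on \<open>X\<close>\<close>

abbreviation X :: "('a^6) set set" where "X \<equiv> affine_pts Q H"

abbreviation conj :: "('a^6) set \<Rightarrow> ('a^6) set" where "conj \<equiv> conj_pt Q H"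

text \<open>Dividing by \<open>Q n\<close> rather than \<open>B n n = 2 * Q n\<close> covers both
  parities: this is the usual reflection for odd q and an orthogonal transvection for even
  q.\<close>

definition reflect :: "'a^6 \<Rightarrow> 'a^6" where
  "reflect x = x - (B x n / Q n) *s n"

lemma affine_ptsE:
  assumes "p \<in> X"
  obtains x where "p = vec.span {x}" "Q x = 0" "x \<notin> H"
proof -
  obtain x where "p = vec.span {x}" "Q x = 0" "\<not> vec.span {x} \<subseteq> H"
    using assms by (auto simp: affine_pts_def quadric_def)
  then show ?thesis using that vec.span_minimal[OF _ sub_H, of "{x}"] by blast
qed

lemma affine_ptsI: "Q x = 0 \<Longrightarrow> x \<notin> H \<Longrightarrow> vec.span {x} \<in> X"
  using vec.span_base[of x "{x}"] vec.subspace_0[OF sub_H]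
  by (auto simp: affine_pts_def quadric_def)

lemma in_H: "x \<in> H \<Longrightarrow> B x n = 0"
  using perp_H vec.span_base[of n "{n}"] by (auto simp: perp_def)

lemma B_reflect: "B (reflect x) n = - B x n"
  using Qn by (simp add: reflect_def B_simps B_self)

lemma reflect_notin: "x \<notin> H \<Longrightarrow> reflect x \<notin> H"
  using B_reflect[of x] Bn[of x] in_H by auto

lemma reflect_reflect: "reflect (reflect x) = x"
  unfolding reflect_def[of "reflect x"] B_reflect by (simp add: reflect_def)

lemma Q_reflect: "Q (reflect x) = Q x"
proof -
  have "reflect x = x + (- B x n / Q n) *s n" by (simp add: reflect_def)
  then show ?thesis
    using Qn by (simp only: Q_add Q_scale) (simp add: B_simps power2_eq_square)
qed

text \<open>Otherwise a nonzero multiple of the nonsingular \<open>n\<close> would be a multiple of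
  the singular \<open>x\<close>.\<close>

lemma span_reflect_neq:
  assumes "Q x = 0" "x \<notin> H"
  shows "vec.span {reflect x} \<noteq> vec.span {x}"
proof
  assume "vec.span {reflect x} = vec.span {x}"
  then have "reflect x \<in> vec.span {x}" using vec.span_base by blast
  then obtain k where k: "reflect x = k *s x" by (auto simp: vec.span_singleton)
  then have "(B x n / Q n) *s n = (1 - k) *s x"
    by (simp add: reflect_def algebra_simps vec.scale_left_diff_distrib)
  then have "Q ((B x n / Q n) *s n) = (1 - k)\<^sup>2 * Q x" by (simp only: Q_scale)
  then show False using Bn[OF assms(2)] Qn assms(1) by (simp add: Q_scale)
qed

text \<open>For singular \<open>x\<close>,
  \<open>Q (a *s n + b *s x) = a * (a * Q n + b * B x n)\<close>. The factor \<open>a\<close> gives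
  the point of \<open>x\<close>, the other factor that of \<open>reflect x\<close>.\<close>

lemma conj_pt_eq:
  assumes "Q x = 0" "x \<notin> H"
  shows "conj (vec.span {x}) = vec.span {reflect x}"
proof -
  have span: "vec.span (perp Q H \<union> vec.span {x}) = vec.span {n, x}"
    unfolding perp_H
  proof (intro subset_antisym vec.span_minimal vec.subspace_span)
    show "vec.span {n} \<union> vec.span {x} \<subseteq> vec.span {n, x}"
      by (intro Un_least vec.span_mono) auto
    have "{n, x} \<subseteq> vec.span {n} \<union> vec.span {x}" by (simp add: vec.span_base)
    then show "{n, x} \<subseteq> vec.span (vec.span {n} \<union> vec.span {x})"
      using vec.span_superset by (rule order.trans)
  qed
  show ?thesis
    unfolding conj_pt_def span
  proof (rule the_equality)
    have "reflect x \<noteq> 0" using reflect_notin[OF assms(2)] vec.subspace_0[OF sub_H] by auto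
    moreover have "vec.span {reflect x} \<subseteq> vec.span {n, x}"
      by (intro vec.span_minimal vec.subspace_span)
         (auto simp: reflect_def intro!: vec.span_diff vec.span_scale intro: vec.span_base)
    ultimately show "vec.span {reflect x} \<in> quadric Q \<and> vec.span {reflect x} \<noteq> vec.span {x} \<and>
        vec.span {reflect x} \<subseteq> vec.span {n, x}"
      using span_reflect_neq[OF assms] Q_reflect assms(1) by (auto simp: quadric_def)
  next
    fix r assume r: "r \<in> quadric Q \<and> r \<noteq> vec.span {x} \<and> r \<subseteq> vec.span {n, x}"
    then obtain y where y: "r = vec.span {y}" "y \<noteq> 0" "Q y = 0" by (auto simp: quadric_def)
    then have "y \<in> vec.span {n, x}" using r vec.span_base by blast
    then obtain a b where ab: "y = a *s n + b *s x"
      by (auto simp: vec.span_insert vec.span_singleton algebra_simps)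
    have scaled: "vec.span {c *s z} = vec.span {z}" if "c \<noteq> 0" for c and z :: "'a^6"
      using that vec.span_image_scale[of "{z}" "\<lambda>_. c"] by simp
    have "a \<noteq> 0"
    proof
      assume "a = 0"
      then have "r = vec.span {x}" using y ab scaled[of b x] by (cases "b = 0") auto
      then show False using r by simp
    qed
    have "a * (a * Q n + b * B x n) = 0"
      using y(3) assms(1) unfolding ab
      by (simp add: Q_add Q_scale B_simps B_commute[of n] power2_eq_square algebra_simps)
    then have "a * Q n + b * B x n = 0" using \<open>a \<noteq> 0\<close> by (simp only: mult_eq_0_iff) simp
    then have a: "a = - b * B x n / Q n"
      using Qn by (simp add: field_simps eq_neg_iff_add_eq_0)
    then have "b \<noteq> 0" using \<open>a \<noteq> 0\<close> by auto
    moreover have "y = b *s reflect x"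
      unfolding ab a by (simp add: reflect_def vec.scale_right_diff_distrib)
    ultimately show "r = vec.span {reflect x}" using y scaled by simp
  qed
qed

lemma conj_in: "p \<in> X \<Longrightarrow> conj p \<in> X"
  by (elim affine_ptsE) (simp add: conj_pt_eq Q_reflect reflect_notin affine_ptsI)

lemma conj_conj: "p \<in> X \<Longrightarrow> conj (conj p) = p"
  by (elim affine_ptsE) (simp add: conj_pt_eq Q_reflect reflect_notin reflect_reflect)

lemma conj_neq: "p \<in> X \<Longrightarrow> conj p \<noteq> p"
  by (elim affine_ptsE) (simp add: conj_pt_eq span_reflect_neq)

section \<open>The relations of the scheme and their eigenvectors\<close>

lemma self_perp: "u \<in> X \<Longrightarrow> u \<subseteq> perp Q u"
  by (elim affine_ptsE) (simp add: self_subset_perp)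

text \<open>\<open>B x y\<close> and \<open>B x (reflect y)\<close> differ by
  \<open>B y n * B x n / Q n\<close>, which is nonzero outside \<open>H\<close>. Using
  \<open>perp\<close> instead of collinearity also covers \<open>u = v\<close> and
  \<open>u = conj v\<close>, because points of \<open>X\<close> lie in their own
  \<open>perp\<close>.\<close>

lemma not_perp_both:
  assumes "u \<in> X" "v \<in> X" "v \<subseteq> perp Q u" "conj v \<subseteq> perp Q u"
  shows False
proof -
  obtain x where x: "u = vec.span {x}" "Q x = 0" "x \<notin> H" using assms(1) affine_ptsE by metis
  obtain y where y: "v = vec.span {y}" "Q y = 0" "y \<notin> H" using assms(2) affine_ptsE by metis
  have "B x y = 0" "B x (reflect y) = 0"
    using assms(3,4) x y by (auto simp: conj_pt_eq dest!: subset_perp_spanD)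
  then show False using Bn[OF x(3)] Bn[OF y(3)] Qn by (simp add: reflect_def B_simps)
qed

text \<open>The five relations partition the pairs: \<open>not_perp_both\<close> excludes the one
  collinearity pattern not listed and keeps the first and last relations apart from the second and
  fourth.\<close>

lemma sum_adj_matrix:
  assumes "u \<in> X" "v \<in> X"
  shows "(\<Sum>k\<le>4. adj_matrix Q H k u v) = 1"
proof -
  have "\<not> (collinear_pts Q u v \<and> collinear_pts Q u (conj v))"
    using not_perp_both[OF assms] by (auto simp: collinear_pts_def)
  moreover have "\<not> collinear_pts Q u (conj v)" if "u = v"
    using not_perp_both[OF assms] self_perp that assms by (auto simp: collinear_pts_def)
  moreover have "\<not> collinear_pts Q u v" if "u = conj v"
    using not_perp_both[OF assms] self_perp that assms by (auto simp: collinear_pts_def)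
  moreover have "v \<noteq> conj v" using conj_neq[OF assms(2)] by simp
  ultimately show ?thesis
    using assms
    by (auto simp: adj_matrix_def scheme_rel_def eval_nat_numeral collinear_pts_def)
qed

lemma eigenspace_0_constant:
  assumes f: "f \<in> eigenspace Q H 0" and "u \<in> X" "w \<in> X"
  shows "f u = f w"
proof -
  define q where "q = real CARD('a)"
  have "CARD('a) \<ge> 2" using card_mono[of UNIV "{0, 1::'a}"] by simp
  then have q: "q \<ge> 2" by (simp add: q_def)
  have sum: "(\<Sum>v\<in>X. f v) = q\<^sup>2 * (q\<^sup>2 - 1) * f u" if u: "u \<in> X" for u
  proof -
    have "(\<Sum>v\<in>X. f v) = (\<Sum>v\<in>X. (\<Sum>k\<le>4. adj_matrix Q H k u v) * f v)"
      using sum_adj_matrix[OF u] by (intro sum.cong) auto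
    also have "\<dots> = (\<Sum>k\<le>4. \<Sum>v\<in>X. adj_matrix Q H k u v * f v)"
      by (simp only: sum_distrib_right) (rule sum.swap)
    also have "\<dots> = (\<Sum>k\<le>4. eigenmatrix q 0 k * f u)"
      using f u by (intro sum.cong) (auto simp: eigenspace_def q_def)
    also have "\<dots> = (\<Sum>k\<le>4. eigenmatrix q 0 k) * f u"
      by (simp add: sum_distrib_right)
    \<comment> \<open>The sum of the valencies, which is |X|.\<close>
    also have "(\<Sum>k\<le>4. eigenmatrix q 0 k) = q\<^sup>2 * (q\<^sup>2 - 1)"
      by (simp add: eigenmatrix_def eval_nat_numeral algebra_simps)
    finally show ?thesis .
  qed
  have "q\<^sup>2 > 1" using q by (intro one_less_power) auto
  then have "q\<^sup>2 * (q\<^sup>2 - 1) \<noteq> 0" by auto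
  then show ?thesis using sum[OF assms(2)] sum[OF assms(3)] by (metis mult_left_cancel)
qed

text \<open>The last adjacency matrix is the permutation matrix of the involution.\<close>

lemma eigenspace_conj:
  assumes g: "g \<in> eigenspace Q H i" and p: "p \<in> X"
  shows "g (conj p) = eigenmatrix (real CARD('a)) i 4 * g p"
proof -
  have "adj_matrix Q H 4 p v = (if v = conj p then 1 else 0)" if "v \<in> X" for v
    using that p conj_conj by (auto simp: adj_matrix_def scheme_rel_def eval_nat_numeral)
  then have "(\<Sum>v\<in>X. adj_matrix Q H 4 p v * g v) = (\<Sum>v\<in>X. if v = conj p then g v else 0)"
    by (intro sum.cong) auto
  also have "\<dots> = g (conj p)" using conj_in[OF p] by (simp add: sum.delta)
  finally show ?thesis using g p by (auto simp: eigenspace_def)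
qed

section \<open>Consequences for intriguing sets\<close>

lemma intriguing_set_conj:
  assumes Y: "intriguing_set Q H i Y"
  shows "i = 1 \<or> i = 3 \<Longrightarrow> p \<in> X \<Longrightarrow> conj p \<in> Y \<longleftrightarrow> p \<notin> Y"
    and "i = 2 \<or> i = 4 \<Longrightarrow> p \<in> X \<Longrightarrow> conj p \<in> Y \<longleftrightarrow> p \<in> Y"
proof -
  obtain f g where f: "f \<in> eigenspace Q H 0" and g: "g \<in> eigenspace Q H i"
    and fg: "indicator Y = (\<lambda>u. f u + g u)" and Y': "Y \<noteq> {}" "Y \<subset> X"
    using Y by (auto simp: intriguing_set_def)
  have ind: "indicator Y p = f p + g p" for p using fun_cong[OF fg] by simp
  have fconj: "f (conj p) = f p" if "p \<in> X" for p
    using eigenspace_0_constant[OF f] conj_in that by blast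
  show "conj p \<in> Y \<longleftrightarrow> p \<in> Y" if "i = 2 \<or> i = 4" "p \<in> X"
  proof -
    have "g (conj p) = g p"
      using that eigenspace_conj[OF g that(2)] by (auto simp: eigenmatrix_def eval_nat_numeral)
    then have "indicator Y (conj p) = (indicator Y p :: real)"
      using fconj[OF that(2)] by (simp add: ind)
    then show ?thesis by (simp add: indicator_def of_bool_def split: if_splits)
  qed
  show "conj p \<in> Y \<longleftrightarrow> p \<notin> Y" if i: "i = 1 \<or> i = 3" and p: "p \<in> X"
  proof -
    have sum: "indicator Y (conj u) + indicator Y u = 2 * f p" if u: "u \<in> X" for u
    proof -
      have "g (conj u) = - g u"
        using i eigenspace_conj[OF g u] by (auto simp: eigenmatrix_def eval_nat_numeral)
      then show ?thesis
        using fconj[OF u] eigenspace_0_constant[OF f u p] by (simp add: ind)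
    qed
    \<comment> \<open>The constant \<open>2 * f p\<close> is a sum of two indicator values at every
      point: a point in \<open>Y\<close> makes it at least 1, a point of \<open>X\<close> outside
      \<open>Y\<close> at most 1.\<close>
    obtain y z where "y \<in> Y" "z \<in> X" "z \<notin> Y" using Y' by auto
    then have "2 * f p \<ge> 1" "2 * f p \<le> 1"
      using sum[of y] sum[of z] Y' by (auto simp: indicator_def of_bool_def split: if_splits)
    then show ?thesis using sum[OF p] by (simp add: indicator_def of_bool_def split: if_splits)
  qed
qed

end

theorem theorem3p3:
  fixes Q :: "'a::{field,finite}^6 \<Rightarrow> 'a"
    and H :: "('a^6) set" and Y :: "('a^6) set set" and i :: nat
  assumes "CARD('a) > 2"
    and "elliptic_form Q"
    and "parabolic_hyperplane Q H"
    and "intriguing_set Q H i Y"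
  shows "(i = 1 \<or> i = 3 \<longrightarrow>
            real (card Y) = 1 / 2 * real (card (affine_pts Q H)) \<and>
            (\<forall>p\<in>affine_pts Q H. card ({p, conj_pt Q H p} \<inter> Y) = 1)) \<and>
         (i = 2 \<or> i = 4 \<longrightarrow> conj_pt Q H ` Y = Y)"
proof -
  interpret quadratic_space Q
    using assms(2) by unfold_locales (simp add: elliptic_form_def)
  obtain n where n: "perp Q H = vec.span {n}" "Q n \<noteq> 0" "\<And>x. x \<notin> H \<Longrightarrow> B x n \<noteq> 0"
    using perp_hyperplane[OF _ assms(3)] assms(2) by (auto simp: elliptic_form_def)
  interpret parabolic_section Q H n
    using n assms(3) by unfold_locales (auto simp: parabolic_hyperplane_def)
  have YX: "Y \<subseteq> X" using assms(4) by (auto simp: intriguing_set_def)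
  show ?thesis
  proof (intro conjI impI ballI)
    assume i: "i = 1 \<or> i = 3"
    note swap = intriguing_set_conj(1)[OF assms(4) i]
    \<comment> \<open>The involution exchanges \<open>Y\<close> with its complement in
      \<open>X\<close> and is its own inverse.\<close>
    have "bij_betw conj Y (X - Y)"
      using YX swap conj_in conj_conj by (intro bij_betw_byWitness[where f' = conj]) auto
    then have "card Y = card (X - Y)" by (rule bij_betw_same_card)
    moreover have "card X = card Y + card (X - Y)"
      using YX card_Diff_subset[of Y X] card_mono[of X Y] by (simp add: finite_subset)
    ultimately show "real (card Y) = 1 / 2 * real (card X)" by simp
    fix p assume p: "p \<in> X"
    have "{p, conj p} \<inter> Y = (if p \<in> Y then {p} else {conj p})" using swap[OF p] by auto
    then show "card ({p, conj p} \<inter> Y) = 1" by simp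
  next
    assume i: "i = 2 \<or> i = 4"
    note inv = intriguing_set_conj(2)[OF assms(4) i]
    show "conj ` Y = Y"
      using YX inv conj_conj by (auto simp: image_iff) (metis subsetD)
  qed
qed

end
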